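(* For every $n\in\mathbb N$ with $n\geq 3$: (i) $\mathrm{sat}^*(n,Y)=n+2$; and (ii) $\mathrm{sat}^*(n,X)=2n+2$.
   Context: $[n]=\{1,\dots,n\}$. $Y$ is the four-element poset $\{a,b,c,d\}$ with $a<b$, $b<c$, $b<d$ (hence $a<c$, $a<d$) and $c,d$ incomparable. $X$ is the five-element poset $\{a,b,c,d,e\}$ with $a<c$, $b<c$, $c<d$, $c<e$ (and the relations implied by transitivity), where $a,b$ are incomparable and $d,e$ are incomparable. Families of sets are ordered by inclusion. A poset $P$ is an induced subposet of a poset $Q$ if there is an injective map $\phi:P\to Q$ such that for all $x,y\in P$, $\phi(x)\leq\phi(y)$ if and only if $x\leq y$; otherwise $Q$ is induced $P$-free. A family $\mathcal F\subseteq 2^{[n]}$ is induced $P$-saturated if $\mathcal F$ is induced $P$-free, but for every $S\subseteq[n]$ with $S\notin\mathcal F$, $P$ is an induced subposet of $\mathcal F\cup\{S\}$. $\mathrm{sat}^*(n,P)$ denotes the size of the smallest induced $P$-saturated family $\mathcal F\subseteq 2^{[n]}$. *)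

theory Defs
  imports Main
begin

text \<open>A poset is represented by its reflexive order relation \<open>P\<close>; its carrier is the field of
  the relation. A family of sets \<open>F\<close> is the poset \<open>relation_of (\<subseteq>) F\<close>.\<close>

definition induced_subposet :: "'p rel \<Rightarrow> 'q rel \<Rightarrow> bool" where
  "induced_subposet P Q \<longleftrightarrow>
     (\<exists>\<phi>. inj_on \<phi> (Field P) \<and> \<phi> ` Field P \<subseteq> Field Q \<and>
          (\<forall>x\<in>Field P. \<forall>y\<in>Field P. (\<phi> x, \<phi> y) \<in> Q \<longleftrightarrow> (x, y) \<in> P))"

definition induced_saturated :: "nat \<Rightarrow> 'p rel \<Rightarrow> nat set set \<Rightarrow> bool" where
  "induced_saturated n P F \<longleftrightarrow>
     F \<subseteq> Pow {1..n} \<and>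
     \<not> induced_subposet P (relation_of (\<subseteq>) F) \<and>
     (\<forall>S. S \<subseteq> {1..n} \<and> S \<notin> F \<longrightarrow> induced_subposet P (relation_of (\<subseteq>) (F \<union> {S})))"

text \<open>The infimum over \<^typ>\<open>nat\<close> is a minimum whenever some induced saturated family exists;
  otherwise it is 0, so a positive value entails existence.\<close>

definition sat_star :: "nat \<Rightarrow> 'p rel \<Rightarrow> nat" where
  "sat_star n P = Inf {card F | F. induced_saturated n P F}"

datatype Y_elem = Ya | Yb | Yc | Yd

definition Y_poset :: "Y_elem rel" where
  "Y_poset = {(Ya, Yb), (Yb, Yc), (Yb, Yd)}\<^sup>*"

datatype X_elem = Xa | Xb | Xc | Xd | Xe

definition X_poset :: "X_elem rel" where
  "X_poset = {(Xa, Xc), (Xb, Xc), (Xc, Xd), (Xc, Xe)}\<^sup>*"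

lemma Field_relation_of_subset: "Field (relation_of (\<subseteq>) F) = F"
  by (auto simp: relation_of_def Field_def)

lemma Y_poset_eq:
  "Y_poset = Id \<union> {(Ya, Yb), (Yb, Yc), (Yb, Yd), (Ya, Yc), (Ya, Yd)}" (is "_ = ?R")
proof (intro equalityI subrelI)
  fix x y assume "(x, y) \<in> Y_poset"
  then show "(x, y) \<in> ?R"
    unfolding Y_poset_def by (induction rule: rtrancl_induct) auto
next
  have ab: "(Ya, Yb) \<in> Y_poset" and bc: "(Yb, Yc) \<in> Y_poset" and bd: "(Yb, Yd) \<in> Y_poset"
    unfolding Y_poset_def by auto
  have tr: "trans Y_poset" and rf: "Id \<subseteq> Y_poset"
    unfolding Y_poset_def by (auto intro: trans_rtrancl)
  fix x y assume "(x, y) \<in> ?R"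
  then show "(x, y) \<in> Y_poset"
    using ab bc bd rf transD[OF tr ab bc] transD[OF tr ab bd] by auto
qed

lemma X_poset_eq:
  "X_poset = Id \<union> {(Xa, Xc), (Xb, Xc), (Xc, Xd), (Xc, Xe),
                    (Xa, Xd), (Xa, Xe), (Xb, Xd), (Xb, Xe)}" (is "_ = ?R")
proof (intro equalityI subrelI)
  fix x y assume "(x, y) \<in> X_poset"
  then show "(x, y) \<in> ?R"
    unfolding X_poset_def by (induction rule: rtrancl_induct) auto
next
  have ac: "(Xa, Xc) \<in> X_poset" and bc: "(Xb, Xc) \<in> X_poset"
    and cd: "(Xc, Xd) \<in> X_poset" and ce: "(Xc, Xe) \<in> X_poset"
    unfolding X_poset_def by auto
  have tr: "trans X_poset" and rf: "Id \<subseteq> X_poset"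
    unfolding X_poset_def by (auto intro: trans_rtrancl)
  fix x y assume "(x, y) \<in> ?R"
  then show "(x, y) \<in> X_poset"
    using ac bc cd ce rf transD[OF tr ac cd] transD[OF tr ac ce]
      transD[OF tr bc cd] transD[OF tr bc ce] by auto
qed

lemma partial_order_Y_poset: "partial_order_on UNIV Y_poset"
  unfolding partial_order_on_def preorder_on_def
  by (auto simp: Y_poset_eq refl_on_def trans_def antisym_def)

lemma partial_order_X_poset: "partial_order_on UNIV X_poset"
  unfolding partial_order_on_def preorder_on_def
  by (auto simp: X_poset_eq refl_on_def trans_def antisym_def)

lemma Field_Y_poset: "Field Y_poset = UNIV"
  by (auto simp: Y_poset_eq Field_def)

lemma Field_X_poset: "Field X_poset = UNIV"
  by (auto simp: X_poset_eq Field_def)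

end

theory Submission
  imports Defs
begin

text \<open>A family is \<open>Y\<close>-free iff its non-minimal members have chains above them, and \<open>X\<close>-free iff
  each member has a chain above it or a chain below it. Let \<open>A\<^sub>0\<close> be a minimal member among those of
  one such kind, so that \<open>A\<^sub>0\<close> starts a chain of members. Each \<open>i \<notin> A\<^sub>0\<close> is assigned a member
  between \<open>{i}\<close> and \<open>A \<union> {i}\<close>, where \<open>A\<close> is the largest set of the chain avoiding \<open>i\<close>, and each
  \<open>j \<in> A\<^sub>0\<close> a maximal member that contains \<open>A\<^sub>0\<close> except for \<open>j\<close>. Saturation provides these members
  and they are distinct, which together with \<open>A\<^sub>0\<close> gives \<open>n + 1\<close>.

  For \<open>Y\<close> some minimal member of the family is left over. For \<open>X\<close> the bound applies to the members
  with a chain above and, by complementation, to those with a chain below, which settles the case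
  that no member is of both kinds. A minimal member \<open>t\<close> of both kinds yields \<open>2n + 2\<close> members
  directly: two near \<open>t\<close> for each point of the ground set except one point, a single one for
  that point, and \<open>\<emptyset>\<close>, \<open>t\<close>, \<open>[n]\<close>.

  Equality holds for the empty set, the full set and all coatoms, and for \<open>X\<close> also the singletons.\<close>

section \<open>The two forbidden posets in terms of chains\<close>

definition up_chain :: "'a set set \<Rightarrow> 'a set \<Rightarrow> bool" where
  "up_chain F b \<longleftrightarrow> (\<forall>c\<in>F. \<forall>d\<in>F. b \<subseteq> c \<longrightarrow> b \<subseteq> d \<longrightarrow> c \<subseteq> d \<or> d \<subseteq> c)"

definition down_chain :: "'a set set \<Rightarrow> 'a set \<Rightarrow> bool" where
  "down_chain F c \<longleftrightarrow> (\<forall>a\<in>F. \<forall>b\<in>F. a \<subseteq> c \<longrightarrow> b \<subseteq> c \<longrightarrow> a \<subseteq> b \<or> b \<subseteq> a)"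

definition contains_Y :: "'a set set \<Rightarrow> bool" where
  "contains_Y F \<longleftrightarrow> (\<exists>b\<in>F. \<not> up_chain F b \<and> (\<exists>a\<in>F. a \<subset> b))"

definition contains_X :: "'a set set \<Rightarrow> bool" where
  "contains_X F \<longleftrightarrow> (\<exists>c\<in>F. \<not> up_chain F c \<and> \<not> down_chain F c)"

definition saturated :: "('a set set \<Rightarrow> bool) \<Rightarrow> 'a set \<Rightarrow> 'a set set \<Rightarrow> bool" where
  "saturated Q N F \<longleftrightarrow> F \<subseteq> Pow N \<and> \<not> Q F \<and> (\<forall>S. S \<subseteq> N \<longrightarrow> S \<notin> F \<longrightarrow> Q (insert S F))"

lemma up_chainD: "up_chain F b \<Longrightarrow> c \<in> F \<Longrightarrow> d \<in> F \<Longrightarrow> b \<subseteq> c \<Longrightarrow> b \<subseteq> d \<Longrightarrow> c \<subseteq> d \<or> d \<subseteq> c"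
  by (auto simp: up_chain_def)

lemma down_chainD: "down_chain F c \<Longrightarrow> a \<in> F \<Longrightarrow> b \<in> F \<Longrightarrow> a \<subseteq> c \<Longrightarrow> b \<subseteq> c \<Longrightarrow> a \<subseteq> b \<or> b \<subseteq> a"
  by (auto simp: down_chain_def)

lemma not_up_chainI: "c \<in> F \<Longrightarrow> d \<in> F \<Longrightarrow> b \<subseteq> c \<Longrightarrow> b \<subseteq> d \<Longrightarrow> \<not> c \<subseteq> d \<Longrightarrow> \<not> d \<subseteq> c \<Longrightarrow> \<not> up_chain F b"
  unfolding up_chain_def by meson

lemma not_down_chainI: "a \<in> F \<Longrightarrow> b \<in> F \<Longrightarrow> a \<subseteq> c \<Longrightarrow> b \<subseteq> c \<Longrightarrow> \<not> a \<subseteq> b \<Longrightarrow> \<not> b \<subseteq> a \<Longrightarrow> \<not> down_chain F c"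
  unfolding down_chain_def by meson

text \<open>The set \<open>b\<close> need not belong to \<open>F\<close>, so this also carries the
  chain property from a member to a missing set such as \<open>insert i A\<close>.\<close>

lemma up_chain_mono: "up_chain F b \<Longrightarrow> b \<subseteq> c \<Longrightarrow> up_chain F c"
  unfolding up_chain_def by (meson order_trans)

lemma down_chain_mono: "down_chain F c \<Longrightarrow> b \<subseteq> c \<Longrightarrow> down_chain F b"
  unfolding down_chain_def by (meson order_trans)

lemma not_up_chainE:
  assumes "\<not> up_chain F b"
  obtains c d where "c \<in> F" "d \<in> F" "b \<subset> c" "b \<subset> d" "\<not> c \<subseteq> d" "\<not> d \<subseteq> c"
  using assms unfolding up_chain_def by (metis order_le_less)

lemma not_down_chainE:
  assumes "\<not> down_chain F c"
  obtains a b where "a \<in> F" "b \<in> F" "a \<subset> c" "b \<subset> c" "\<not> a \<subseteq> b" "\<not> b \<subseteq> a"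
  using assms unfolding down_chain_def by (metis order_le_less)

text \<open>The fork of \<open>Y\<close> is a pair of incomparable members above \<open>b\<close>,
  that is, a failure of \<open>up_chain\<close>. All relations between \<open>a\<close> and the tips
  of the fork follow by transitivity through \<open>b\<close>.\<close>

lemma induced_subposet_Y_iff:
  "induced_subposet Y_poset (relation_of (\<subseteq>) F) \<longleftrightarrow> contains_Y F"
proof
  assume "induced_subposet Y_poset (relation_of (\<subseteq>) F)"
  then obtain \<phi> where im: "range \<phi> \<subseteq> F"
    and rel: "\<forall>x y. (\<phi> x, \<phi> y) \<in> relation_of (\<subseteq>) F \<longleftrightarrow> (x, y) \<in> Y_poset"
    unfolding induced_subposet_def Field_Y_poset Field_relation_of_subset by auto
  have iff: "\<phi> x \<subseteq> \<phi> y \<longleftrightarrow> (x, y) \<in> Y_poset" for x y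
    using rel im by (simp add: relation_of_def image_subset_iff)
  have el: "\<phi> x \<in> F" for x using im by auto
  have "\<phi> Ya \<subset> \<phi> Yb"
    by (simp add: iff Y_poset_eq less_le_not_le)
  moreover have "\<not> up_chain F (\<phi> Yb)"
    by (rule not_up_chainI[of "\<phi> Yc" _ "\<phi> Yd"]) (simp_all add: el iff Y_poset_eq)
  ultimately show "contains_Y F"
    unfolding contains_Y_def using el by blast
next
  assume "contains_Y F"
  then obtain a b c d where el: "a \<in> F" "b \<in> F" "c \<in> F" "d \<in> F"
    and ab: "a \<subset> b" and up: "b \<subset> c" "b \<subset> d" "\<not> c \<subseteq> d" "\<not> d \<subseteq> c"
    unfolding contains_Y_def by (metis not_up_chainE)
  let ?\<phi> = "\<lambda>x. case x of Ya \<Rightarrow> a | Yb \<Rightarrow> b | Yc \<Rightarrow> c | Yd \<Rightarrow> d"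
  have iff: "?\<phi> x \<subseteq> ?\<phi> y \<longleftrightarrow> (x, y) \<in> Y_poset" for x y
  proof -
    have "a \<subseteq> b" "a \<subseteq> c" "a \<subseteq> d" "b \<subseteq> c" "b \<subseteq> d"
      "\<not> b \<subseteq> a" "\<not> c \<subseteq> a" "\<not> d \<subseteq> a" "\<not> c \<subseteq> b" "\<not> d \<subseteq> b"
      using ab up by blast+
    with up(3,4) show ?thesis by (cases x; cases y) (simp_all add: Y_poset_eq)
  qed
  have im: "?\<phi> x \<in> F" for x
    using el by (cases x) auto
  have "inj ?\<phi>"
    by (rule injI) (metis iff antisymD partial_order_Y_poset partial_order_on_def subset_refl)
  then show "induced_subposet Y_poset (relation_of (\<subseteq>) F)"
    unfolding induced_subposet_def Field_Y_poset Field_relation_of_subset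
    using iff im by (intro exI[of _ ?\<phi>]) (auto simp: relation_of_def)
qed

lemma induced_subposet_X_iff:
  "induced_subposet X_poset (relation_of (\<subseteq>) F) \<longleftrightarrow> contains_X F"
proof
  assume "induced_subposet X_poset (relation_of (\<subseteq>) F)"
  then obtain \<phi> where im: "range \<phi> \<subseteq> F"
    and rel: "\<forall>x y. (\<phi> x, \<phi> y) \<in> relation_of (\<subseteq>) F \<longleftrightarrow> (x, y) \<in> X_poset"
    unfolding induced_subposet_def Field_X_poset Field_relation_of_subset by auto
  have iff: "\<phi> x \<subseteq> \<phi> y \<longleftrightarrow> (x, y) \<in> X_poset" for x y
    using rel im by (simp add: relation_of_def image_subset_iff)
  have el: "\<phi> x \<in> F" for x using im by auto
  have "\<not> down_chain F (\<phi> Xc)"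
    by (rule not_down_chainI[of "\<phi> Xa" _ "\<phi> Xb"]) (simp_all add: el iff X_poset_eq)
  moreover have "\<not> up_chain F (\<phi> Xc)"
    by (rule not_up_chainI[of "\<phi> Xd" _ "\<phi> Xe"]) (simp_all add: el iff X_poset_eq)
  ultimately show "contains_X F"
    unfolding contains_X_def using el by blast
next
  assume "contains_X F"
  then obtain a b c d e where el: "a \<in> F" "b \<in> F" "c \<in> F" "d \<in> F" "e \<in> F"
    and down: "a \<subset> c" "b \<subset> c" "\<not> a \<subseteq> b" "\<not> b \<subseteq> a"
    and up: "c \<subset> d" "c \<subset> e" "\<not> d \<subseteq> e" "\<not> e \<subseteq> d"
    unfolding contains_X_def by (metis not_up_chainE not_down_chainE)
  let ?\<phi> = "\<lambda>x. case x of Xa \<Rightarrow> a | Xb \<Rightarrow> b | Xc \<Rightarrow> c | Xd \<Rightarrow> d | Xe \<Rightarrow> e"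
  have iff: "?\<phi> x \<subseteq> ?\<phi> y \<longleftrightarrow> (x, y) \<in> X_poset" for x y
  proof -
    have "a \<subseteq> c" "b \<subseteq> c" "a \<subseteq> d" "b \<subseteq> d" "a \<subseteq> e" "b \<subseteq> e" "c \<subseteq> d" "c \<subseteq> e"
      "\<not> c \<subseteq> a" "\<not> d \<subseteq> a" "\<not> e \<subseteq> a" "\<not> c \<subseteq> b" "\<not> d \<subseteq> b" "\<not> e \<subseteq> b" "\<not> d \<subseteq> c" "\<not> e \<subseteq> c"
      using down up by blast+
    with down(3,4) up(3,4) show ?thesis by (cases x; cases y) (simp_all add: X_poset_eq)
  qed
  have im: "?\<phi> x \<in> F" for x
    using el by (cases x) auto
  have "inj ?\<phi>"
    by (rule injI) (metis iff antisymD partial_order_X_poset partial_order_on_def subset_refl)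
  then show "induced_subposet X_poset (relation_of (\<subseteq>) F)"
    unfolding induced_subposet_def Field_X_poset Field_relation_of_subset
    using iff im by (intro exI[of _ ?\<phi>]) (auto simp: relation_of_def)
qed

section \<open>Saturation, the roles of a missing set, and a general lower bound\<close>

lemma induced_saturated_Y_iff: "induced_saturated n Y_poset F \<longleftrightarrow> saturated contains_Y {1..n} F"
  unfolding induced_saturated_def saturated_def induced_subposet_Y_iff by auto

lemma induced_saturated_X_iff: "induced_saturated n X_poset F \<longleftrightarrow> saturated contains_X {1..n} F"
  unfolding induced_saturated_def saturated_def induced_subposet_X_iff by auto

text \<open>Since \<open>F\<close> is free of \<open>Y\<close>, the copy created by \<open>S\<close>
  uses \<open>S\<close>: as the middle element, as the bottom, or as one of the two interchangeable
  tops.\<close>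

lemma saturated_Y_cases:
  assumes sat: "saturated contains_Y N F" and S: "S \<subseteq> N" "S \<notin> F"
  obtains (mid) a where "\<not> up_chain F S" "a \<in> F" "a \<subset> S"
  | (bottom) b where "b \<in> F" "S \<subset> b" "\<not> up_chain F b"
  | (top) a b d where "a \<in> F" "b \<in> F" "d \<in> F" "a \<subset> b" "b \<subset> S" "b \<subset> d" "\<not> d \<subseteq> S" "\<not> S \<subseteq> d"
proof -
  have free: "\<not> contains_Y F" and "contains_Y (insert S F)"
    using sat S by (auto simp: saturated_def)
  then obtain a b where ab: "b \<in> insert S F" "a \<in> insert S F" "a \<subset> b" and "\<not> up_chain (insert S F) b"
    unfolding contains_Y_def by blast
  then obtain c d where cd: "c \<in> insert S F" "d \<in> insert S F" "b \<subset> c" "b \<subset> d" "\<not> c \<subseteq> d" "\<not> d \<subseteq> c"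
    by (metis not_up_chainE)
  consider "b = S" | "a = S" | "c = S" | "d = S" | "b \<in> F" "a \<in> F" "c \<in> F" "d \<in> F"
    using ab cd by blast
  then show thesis
  proof cases
    case 1
    then have el: "a \<in> F" "c \<in> F" "d \<in> F" using ab cd by blast+
    have "\<not> up_chain F S" by (rule not_up_chainI[of c F d]) (use el cd 1 in auto)
    then show thesis using mid el ab 1 by blast
  next
    case 2
    then have el: "b \<in> F" "c \<in> F" "d \<in> F" using ab cd by blast+
    have "\<not> up_chain F b" by (rule not_up_chainI[of c F d]) (use el cd in auto)
    then show thesis using bottom el ab 2 by blast
  next
    case 3
    then have "a \<in> F" "b \<in> F" "d \<in> F" using ab cd by blast+
    then show thesis using top[of a b d] ab cd 3 by blast
  next
    case 4
    then have "a \<in> F" "b \<in> F" "c \<in> F" using ab cd by blast+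
    then show thesis using top[of a b c] ab cd 4 by blast
  next
    case 5
    have "\<not> up_chain F b" by (rule not_up_chainI[of c F d]) (use 5 cd in auto)
    then have "contains_Y F"
      using ab 5 unfolding contains_Y_def by blast
    then show thesis using free by blast
  qed
qed

text \<open>Again \<open>S\<close> plays a role in the new copy: the centre, a lower element or an
  upper one. The case \<open>bottom\<close> records the fork above the centre, the case
  \<open>top\<close> the failing chain below it and the other upper element
  \<open>e\<close>.\<close>

lemma saturated_X_cases:
  assumes sat: "saturated contains_X N F" and S: "S \<subseteq> N" "S \<notin> F"
  obtains (mid) "\<not> up_chain F S" "\<not> down_chain F S"
  | (bottom) c where "c \<in> F" "S \<subset> c" "\<not> up_chain F c"
  | (top) c e where "c \<in> F" "e \<in> F" "\<not> down_chain F c" "c \<subset> S" "c \<subset> e" "\<not> e \<subseteq> S" "\<not> S \<subseteq> e"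
proof -
  have free: "\<not> contains_X F" and "contains_X (insert S F)"
    using sat S by (auto simp: saturated_def)
  then obtain c where c: "c \<in> insert S F" "\<not> down_chain (insert S F) c" "\<not> up_chain (insert S F) c"
    unfolding contains_X_def by blast
  then obtain a b where ab: "a \<in> insert S F" "b \<in> insert S F" "a \<subset> c" "b \<subset> c" "\<not> a \<subseteq> b" "\<not> b \<subseteq> a"
    by (metis not_down_chainE)
  obtain d e where de: "d \<in> insert S F" "e \<in> insert S F" "c \<subset> d" "c \<subset> e" "\<not> d \<subseteq> e" "\<not> e \<subseteq> d"
    using c by (metis not_up_chainE)
  consider "c = S" | "c \<in> F" "a = S \<or> b = S" | "c \<in> F" "d = S" | "c \<in> F" "e = S"
    | "c \<in> F" "a \<in> F" "b \<in> F" "d \<in> F" "e \<in> F"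
    using c ab de by blast
  then show thesis
  proof cases
    case 1
    then have el: "a \<in> F" "b \<in> F" "d \<in> F" "e \<in> F" using ab de by blast+
    have "\<not> up_chain F S" by (rule not_up_chainI[of d F e]) (use el de 1 in auto)
    moreover have "\<not> down_chain F S" by (rule not_down_chainI[of a F b]) (use el ab 1 in auto)
    ultimately show thesis using mid by blast
  next
    case 2
    then have S: "S \<subset> c" using ab by blast
    then have el: "d \<in> F" "e \<in> F" using de by blast+
    have "\<not> up_chain F c" by (rule not_up_chainI[of d F e]) (use el de in auto)
    with S show thesis using bottom 2 by blast
  next
    case 3
    then have el: "e \<in> F" "a \<in> F" "b \<in> F" using ab de by blast+
    have "\<not> down_chain F c" by (rule not_down_chainI[of a F b]) (use el ab in auto)
    with el show thesis using top[of c e] 3 de by blast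
  next
    case 4
    then have el: "d \<in> F" "a \<in> F" "b \<in> F" using ab de by blast+
    have "\<not> down_chain F c" by (rule not_down_chainI[of a F b]) (use el ab in auto)
    with el show thesis using top[of c d] 4 de by blast
  next
    case 5
    have "\<not> up_chain F c" by (rule not_up_chainI[of d F e]) (use 5 de in auto)
    moreover have "\<not> down_chain F c" by (rule not_down_chainI[of a F b]) (use 5 ab in auto)
    ultimately have "contains_X F"
      using 5 unfolding contains_X_def by blast
    then show thesis using free by blast
  qed
qed

text \<open>Each \<open>i\<close> outside \<open>A0\<close> is mapped to a member \<open>f i\<close>
  that contains \<open>i\<close> and otherwise lies in the largest chain member \<open>A i\<close>
  avoiding \<open>i\<close>; each \<open>j\<close> in \<open>A0\<close> is mapped to a member
  \<open>h j\<close> that misses only \<open>j\<close> among the points of \<open>A0\<close>.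
  Neither kind equals \<open>A0\<close>. The set \<open>d\<close> in the second hypothesis on
  \<open>i\<close> serves to separate the two kinds.\<close>

lemma card_ge_Suc_ground_set:
  assumes N: "finite N" and H: "H \<subseteq> Pow N" and A0: "A0 \<in> H" and chain: "up_chain H A0"
    and outside: "\<And>A i. \<lbrakk>A \<in> H; A0 \<subseteq> A; i \<in> N - A; \<And>B. \<lbrakk>B \<in> H; A0 \<subseteq> B; i \<notin> B\<rbrakk> \<Longrightarrow> B \<subseteq> A\<rbrakk>
      \<Longrightarrow> insert i A \<in> H \<or>
          (\<exists>b\<in>H. \<exists>d\<in>H. i \<in> b \<and> b \<subseteq> insert i A \<and> b \<subset> d \<and> \<not> d \<subseteq> insert i A \<and> \<not> insert i A \<subseteq> d)"
    and inside: "\<And>j. j \<in> A0 \<Longrightarrow> \<exists>C\<in>H. A0 - {j} \<subseteq> C \<and> j \<notin> C"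
  shows "card N + 1 \<le> card H"
proof -
  have finH: "finite H" using N H by (meson finite_Pow_iff finite_subset)
  have "\<exists>A\<in>H. A0 \<subseteq> A \<and> i \<notin> A \<and> (\<forall>B\<in>H. A0 \<subseteq> B \<longrightarrow> i \<notin> B \<longrightarrow> B \<subseteq> A)" if "i \<in> N - A0" for i
  proof -
    have "finite {A \<in> H. A0 \<subseteq> A \<and> i \<notin> A}" "A0 \<in> {A \<in> H. A0 \<subseteq> A \<and> i \<notin> A}"
      using finH A0 that by auto
    from finite_has_maximal2[OF this] obtain A
      where A: "A \<in> H" "A0 \<subseteq> A" "i \<notin> A"
        and max: "\<And>B. B \<in> H \<Longrightarrow> A0 \<subseteq> B \<Longrightarrow> i \<notin> B \<Longrightarrow> A \<subseteq> B \<Longrightarrow> A = B"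
      by auto
    show ?thesis
    proof (intro bexI[of _ A] conjI ballI impI)
      fix B assume "B \<in> H" "A0 \<subseteq> B" "i \<notin> B"
      then show "B \<subseteq> A" using up_chainD[OF chain A(1) _ A(2)] max by blast
    qed (use A in auto)
  qed
  then obtain A where A: "\<And>i. i \<in> N - A0 \<Longrightarrow> A i \<in> H \<and> A0 \<subseteq> A i \<and> i \<notin> A i"
    and Amax: "\<And>i B. i \<in> N - A0 \<Longrightarrow> B \<in> H \<Longrightarrow> A0 \<subseteq> B \<Longrightarrow> i \<notin> B \<Longrightarrow> B \<subseteq> A i"
    by metis
  have "\<exists>b\<in>H. i \<in> b \<and> b \<subseteq> insert i (A i) \<and> (b = insert i (A i) \<or>
      (\<exists>d\<in>H. b \<subset> d \<and> \<not> d \<subseteq> insert i (A i) \<and> \<not> insert i (A i) \<subseteq> d))" if i: "i \<in> N - A0" for i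
  proof -
    have "i \<in> N - A i" using i A by blast
    then consider "insert i (A i) \<in> H" | b d where "b \<in> H" "d \<in> H" "i \<in> b" "b \<subseteq> insert i (A i)"
        "b \<subset> d" "\<not> d \<subseteq> insert i (A i)" "\<not> insert i (A i) \<subseteq> d"
      using outside[of "A i" i] A[OF i] Amax[OF i] by blast
    then show ?thesis
    proof cases
      case 1
      then show ?thesis by (intro bexI[of _ "insert i (A i)"]) auto
    next
      case 2
      then show ?thesis by (intro bexI[of _ b] conjI disjI2 bexI[of _ d])
    qed
  qed
  then obtain f where f: "\<And>i. i \<in> N - A0 \<Longrightarrow> f i \<in> H \<and> i \<in> f i \<and> f i \<subseteq> insert i (A i)"
    and f_or: "\<And>i. i \<in> N - A0 \<Longrightarrow> f i = insert i (A i) \<or>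
      (\<exists>d\<in>H. f i \<subset> d \<and> \<not> d \<subseteq> insert i (A i) \<and> \<not> insert i (A i) \<subseteq> d)"
    by metis
  \<comment> \<open>Choosing \<open>h j\<close> maximal makes every larger member contain
    \<open>j\<close>, which is used against \<open>d\<close> below.\<close>
  have "\<exists>C\<in>H. A0 - {j} \<subseteq> C \<and> j \<notin> C \<and> (\<forall>d\<in>H. C \<subset> d \<longrightarrow> j \<in> d)" if "j \<in> A0" for j
  proof -
    from inside[OF that] obtain C0 where C0: "C0 \<in> {C \<in> H. A0 - {j} \<subseteq> C \<and> j \<notin> C}"
      by auto
    from finite_has_maximal2[OF _ C0] finH obtain C
      where "C \<in> H" "A0 - {j} \<subseteq> C" "j \<notin> C"
        and "\<And>B. B \<in> H \<Longrightarrow> A0 - {j} \<subseteq> B \<Longrightarrow> j \<notin> B \<Longrightarrow> C \<subseteq> B \<Longrightarrow> C = B"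
      by auto
    then show ?thesis by (intro bexI[of _ C]) blast+
  qed
  then obtain h where h: "\<And>j. j \<in> A0 \<Longrightarrow> h j \<in> H \<and> A0 - {j} \<subseteq> h j \<and> j \<notin> h j"
    and hmax: "\<And>j d. j \<in> A0 \<Longrightarrow> d \<in> H \<Longrightarrow> h j \<subset> d \<Longrightarrow> j \<in> d"
    by metis
  have f_neq_f: "f i \<noteq> f i'" if "i \<in> N - A0" "i' \<in> N - A0" "i \<noteq> i'" for i i'
  proof
    assume eq: "f i = f i'"
    then have "i' \<in> A i" "i \<in> A i'" using f[OF that(1)] f[OF that(2)] that(3) by auto
    moreover have "A i \<subseteq> A i' \<or> A i' \<subseteq> A i"
      using A[OF that(1)] A[OF that(2)] up_chainD[OF chain] by blast
    ultimately show False using A[OF that(1)] A[OF that(2)] by blast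
  qed
  have h_neq_h: "h j \<noteq> h j'" if "j \<in> A0" "j' \<in> A0" "j \<noteq> j'" for j j'
  proof -
    have "j \<in> h j'" using h[OF that(2)] that by auto
    then show ?thesis using h[OF that(1)] by auto
  qed
  have f_neq_h: "f i \<noteq> h j" if i: "i \<in> N - A0" and j: "j \<in> A0" for i j
  proof
    assume eq: "f i = h j"
    \<comment> \<open>\<open>h j\<close> misses \<open>j\<close>, a point of \<open>A0\<close> and
      so of \<open>A i\<close>; hence \<open>f i\<close> comes with a set \<open>d\<close>. By
      maximality \<open>d\<close> contains \<open>j\<close>, thus all of \<open>A0\<close>, and the
      chain makes it comparable to \<open>A i\<close>. As \<open>i\<close> is in \<open>d\<close>,
      it is then comparable to \<open>insert i (A i)\<close> as well.\<close>
    have "f i \<noteq> insert i (A i)" using A[OF i] h[OF j] eq j by auto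
    then obtain d where d: "d \<in> H" "f i \<subset> d" "\<not> d \<subseteq> insert i (A i)" "\<not> insert i (A i) \<subseteq> d"
      using f_or[OF i] by blast
    then have "j \<in> d" using hmax[OF j] eq by auto
    then have "A0 \<subseteq> d" using d h[OF j] eq by auto
    then have "d \<subseteq> A i \<or> A i \<subseteq> d" using up_chainD[OF chain d(1)] A[OF i] by blast
    then show False using d f[OF i] by blast
  qed
  let ?g = "\<lambda>i. if i \<in> A0 then h i else f i"
  have "inj_on ?g N"
  proof (rule inj_onI)
    fix x y assume xy: "x \<in> N" "y \<in> N" "?g x = ?g y"
    then show "x = y"
      using f_neq_f[of x y] h_neq_h[of x y] f_neq_h[of x y] f_neq_h[of y x] by (auto split: if_splits)
  qed
  moreover have "?g ` N \<subseteq> H - {A0}"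
    using f h by auto
  ultimately have "card N \<le> card (H - {A0})"
    using card_inj_on_le finH by blast
  moreover have "card H > 0" using A0 finH card_gt_0_iff by blast
  ultimately show ?thesis using A0 finH by simp
qed


section \<open>The value for \<open>Y\<close>\<close>

lemma saturated_Y_top:
  assumes "saturated contains_Y N F"
  shows "N \<in> F"
proof (rule ccontr)
  assume N: "N \<notin> F"
  have F: "F \<subseteq> Pow N" using assms by (simp add: saturated_def)
  from assms subset_refl N show False
  proof (cases rule: saturated_Y_cases)
    case mid
    then show False using F by (elim not_up_chainE) blast
  qed (use F in blast)+
qed

text \<open>Distinct singletons are incomparable. A missing singleton cannot be a top, since
  \<open>a \<subset> b \<subset> {p}\<close> is impossible; its other roles yield a fork, whose tips
  are nonempty.\<close>

lemma saturated_Y_not_chain: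
  assumes sat: "saturated contains_Y N F" and xy: "x \<in> N" "y \<in> N" "x \<noteq> y"
  shows "\<exists>c\<in>F. \<exists>d\<in>F. c \<noteq> {} \<and> d \<noteq> {} \<and> \<not> c \<subseteq> d \<and> \<not> d \<subseteq> c"
proof (cases "{x} \<in> F \<and> {y} \<in> F")
  case True
  then show ?thesis using xy by blast
next
  case False
  then obtain p where p: "{p} \<subseteq> N" "{p} \<notin> F" using xy by blast
  have *: ?thesis if "\<not> up_chain F b" for b
    using that by (elim not_up_chainE) blast
  from sat p show ?thesis
  proof (cases rule: saturated_Y_cases)
    case (top a b d)
    then show ?thesis by blast
  qed (use * in blast)+
qed

lemma card_saturated_Y_ge:
  fixes N :: "'a set"
  assumes N: "finite N" "card N \<ge> 2" and sat: "saturated contains_Y N F"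
  shows "card N + 2 \<le> card F"
proof -
  have F: "F \<subseteq> Pow N" and free: "\<not> contains_Y F" using sat by (auto simp: saturated_def)
  have finF: "finite F" using N F by (meson finite_Pow_iff finite_subset)
  \<comment> \<open>The non-minimal members: freeness from \<open>Y\<close> forces a chain above
    each of them.\<close>
  define G where "G = {b \<in> F. \<exists>a\<in>F. a \<subset> b}"
  have G_up: "up_chain F b" if "b \<in> G" for b
    using that free unfolding G_def contains_Y_def by blast
  have GI: "c \<in> G" if "b \<in> F" "c \<in> F" "b \<subset> c" for b c
    using that unfolding G_def by blast
  have finG: "finite G" using finF by (simp add: G_def)
  obtain x y where xy: "x \<in> N" "y \<in> N" "x \<noteq> y"
    using N by (metis card_le_Suc0_iff_eq not_less_eq_eq numeral_2_eq_2)
  \<comment> \<open>If the empty set is in \<open>F\<close>, all nonempty members are non-minimal.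
    If it is missing, it can only play the bottom, and the tips of the fork above \<open>b\<close>
    are non-minimal.\<close>
  have "\<exists>c\<in>G. \<exists>d\<in>G. \<not> c \<subseteq> d \<and> \<not> d \<subseteq> c"
  proof (cases "{} \<in> F")
    case True
    obtain c d where "c \<in> F" "d \<in> F" "c \<noteq> {}" "d \<noteq> {}" "\<not> c \<subseteq> d" "\<not> d \<subseteq> c"
      using saturated_Y_not_chain[OF sat xy] by blast
    moreover have "c \<in> G" "d \<in> G" using GI[OF True] calculation by blast+
    ultimately show ?thesis by blast
  next
    case False
    from sat empty_subsetI False show ?thesis
    proof (cases rule: saturated_Y_cases)
      case (bottom b)
      then show ?thesis by (elim not_up_chainE) (meson GI)
    qed blast+
  qed
  then obtain c0 d0 where cd0: "c0 \<in> G" "d0 \<in> G" "\<not> c0 \<subseteq> d0" "\<not> d0 \<subseteq> c0" by blast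
  obtain A0 where A0: "A0 \<in> G" and min: "\<And>B. B \<in> G \<Longrightarrow> B \<subseteq> A0 \<Longrightarrow> B = A0"
    using finite_has_minimal[OF finG] cd0 by blast
  \<comment> \<open>\<open>c0\<close> and \<open>d0\<close> cannot both contain \<open>A0\<close>,
    as the members above \<open>A0\<close> form a chain.\<close>
  obtain A1 where A1: "A1 \<in> G" "\<not> A0 \<subseteq> A1"
    using cd0 up_chainD[OF G_up[OF A0]] by (metis (no_types, lifting) G_def mem_Collect_eq)
  \<comment> \<open>A minimal member \<open>m\<close> below \<open>A1\<close> is the one left over:
    the general bound is applied to \<open>F\<close> without \<open>m\<close>.\<close>
  let ?B = "{a \<in> F. a \<subset> A1}"
  have "?B \<noteq> {}" "finite ?B"
    using A1 finF by (auto simp: G_def)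
  from finite_has_minimal[OF this(2,1)] obtain m where mB: "m \<in> ?B" and mmin: "\<forall>a\<in>?B. a \<le> m \<longrightarrow> m = a"
    by blast
  have m: "m \<in> F" "m \<subset> A1" using mB by simp_all
  have m_nG: "m \<notin> G"
  proof
    assume "m \<in> G"
    then obtain a where "a \<in> F" "a \<subset> m" by (auto simp: G_def)
    moreover have "a \<in> ?B" using calculation m(2) by simp
    ultimately show False using mmin by auto
  qed
  let ?H = "F - {m}"
  have A0F: "A0 \<in> F" and GH: "G \<subseteq> ?H" using A0 m_nG by (auto simp: G_def)
  note A0_chain = up_chainD[OF G_up[OF A0]]
  have "card N + 1 \<le> card ?H"
  proof (rule card_ge_Suc_ground_set)
    show "finite N" by fact
    show "?H \<subseteq> Pow N" using F by blast
    show "A0 \<in> ?H" using A0 GH by blast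
    show "up_chain ?H A0" using G_up[OF A0] by (auto simp: up_chain_def)
  next
    fix A i assume A: "A \<in> ?H" "A0 \<subseteq> A" "i \<in> N - A"
      and Amax: "\<And>B. \<lbrakk>B \<in> ?H; A0 \<subseteq> B; i \<notin> B\<rbrakk> \<Longrightarrow> B \<subseteq> A"
    let ?S = "insert i A"
    show "?S \<in> ?H \<or> (\<exists>b\<in>?H. \<exists>d\<in>?H. i \<in> b \<and> b \<subseteq> ?S \<and> b \<subset> d \<and> \<not> d \<subseteq> ?S \<and> \<not> ?S \<subseteq> d)"
    proof (cases "?S \<in> F")
      case True
      then have "?S \<in> G" using GI[of A ?S] A by blast
      then show ?thesis using GH by blast
    next
      case False
      have up: "up_chain F ?S" using up_chain_mono[OF G_up[OF A0], of ?S] A by blast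
      have "?S \<subseteq> N" using A F by blast
      from sat this False show ?thesis
      proof (cases rule: saturated_Y_cases)
        case (mid a)
        then show ?thesis using up by blast
      next
        case (bottom b)
        then show ?thesis using up_chain_mono[OF up, of b] by blast
      next
        case (top a b d)
        have bG: "b \<in> G" using GI top by blast
        have dG: "d \<in> G" using GI[of b d] top by blast
        \<comment> \<open>Otherwise \<open>b \<subseteq> A\<close>, so \<open>d\<close> and
          \<open>A\<close> are comparable. This leaves \<open>A \<subseteq> d\<close> with
          \<open>i\<close> not in \<open>d\<close>, and then \<open>d \<subseteq> A\<close> by the
          choice of \<open>A\<close>.\<close>
        have "i \<in> b"
        proof (rule ccontr)
          assume "i \<notin> b"
          then have "b \<subseteq> A" using top by blast
          then have "d \<subseteq> A \<or> A \<subseteq> d" using up_chainD[OF G_up[OF bG], of d A] top A by blast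
          then have "A \<subseteq> d" "i \<notin> d" using top by blast+
          then have "d \<subseteq> A" using Amax[of d] dG GH A by blast
          then show False using top by blast
        qed
        then show ?thesis using top bG dG GH by (intro disjI2 bexI[of _ b] bexI[of _ d]) auto
      qed
    qed
  next
    fix j assume j: "j \<in> A0"
    let ?S = "A0 - {j}"
    have two: "j \<notin> c \<or> j \<notin> d"
      if "c \<in> F" "d \<in> F" "?S \<subseteq> c" "?S \<subseteq> d" "\<not> c \<subseteq> d" "\<not> d \<subseteq> c" for c d
      using A0_chain[of c d] that by blast
    show "\<exists>C\<in>?H. ?S \<subseteq> C \<and> j \<notin> C"
    proof (cases "?S \<in> F")
      case True
      show ?thesis
      proof (cases "?S = m")
        case True
        \<comment> \<open>The removed member \<open>m\<close> is replaced by \<open>A1\<close>,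
          which contains \<open>m\<close> but not all of \<open>A0\<close>, and therefore misses
          \<open>j\<close>.\<close>
        then have "?S \<subseteq> A1" "j \<notin> A1" using m A1 by auto
        then show ?thesis using A1 GH by blast
      next
        case False
        then show ?thesis using True by blast
      qed
    next
      case False
      have "?S \<subseteq> N" using A0F F by blast
      from sat this False have "\<exists>C\<in>G. ?S \<subseteq> C \<and> j \<notin> C"
      proof (cases rule: saturated_Y_cases)
        case (mid a)
        from mid(1) obtain c d where cd: "c \<in> F" "d \<in> F" "?S \<subset> c" "?S \<subset> d" "\<not> c \<subseteq> d" "\<not> d \<subseteq> c"
          by (elim not_up_chainE)
        then have "c \<in> G" "d \<in> G" using GI[of a] mid by blast+
        then show ?thesis using two[of c d] cd by blast
      next
        case (bottom b)
        from bottom(3) obtain c d where cd: "c \<in> F" "d \<in> F" "b \<subset> c" "b \<subset> d" "\<not> c \<subseteq> d" "\<not> d \<subseteq> c"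
          by (elim not_up_chainE)
        then have "c \<in> G" "d \<in> G" using GI[of b] bottom by blast+
        then show ?thesis using two[of c d] cd bottom by blast
      next
        case (top a b d)
        then have "b \<in> G" using GI by blast
        then show ?thesis using min[of b] top j by blast
      qed
      then show ?thesis using GH by blast
    qed
  qed
  moreover have "card F > 0" using m(1) finF card_gt_0_iff by blast
  ultimately show ?thesis using m(1) finF by simp
qed

lemma card_coatoms: "finite N \<Longrightarrow> card ((\<lambda>i. N - {i}) ` N) = card N"
  by (intro card_image inj_onI) blast

text \<open>The tips of a fork are incomparable, hence coatoms, so the fork starts at the empty set
  and has nothing below it. A missing set omits two points, which puts two coatoms above it, and the
  empty set lies below. With at least two points no coatom is empty.\<close>

lemma saturated_Y_coatoms:
  assumes N: "finite N" "card N \<ge> 2"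
  defines "F \<equiv> {{}, N} \<union> (\<lambda>i. N - {i}) ` N"
  shows "saturated contains_Y N F" and "card F = card N + 2"
proof -
  have "N \<noteq> {}" using N by auto
  have ne: "N - {i} \<noteq> {}" for i
  proof
    assume "N - {i} = {}"
    then have "card N \<le> card {i}" by (intro card_mono) auto
    then show False using N by simp
  qed
  have "card F = card {{}, N} + card ((\<lambda>i. N - {i}) ` N)"
    unfolding F_def using N ne by (intro card_Un_disjoint) auto
  then show "card F = card N + 2" using \<open>N \<noteq> {}\<close> card_coatoms[OF N(1)] by auto
  show "saturated contains_Y N F"
    unfolding saturated_def
  proof (intro conjI allI impI)
    show "F \<subseteq> Pow N" by (auto simp: F_def)
    show "\<not> contains_Y F"
    proof
      assume "contains_Y F"
      then obtain a b c d where *: "a \<in> F" "b \<in> F" "c \<in> F" "d \<in> F" "a \<subset> b" "b \<subset> c" "b \<subset> d"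
        "\<not> c \<subseteq> d" "\<not> d \<subseteq> c"
        unfolding contains_Y_def by (metis not_up_chainE)
      then have "c \<noteq> N" "d \<noteq> N" by (auto simp: F_def)
      then have "b \<notin> {N} \<union> (\<lambda>i. N - {i}) ` N" "b \<noteq> {}" using * by (auto simp: F_def)
      then show False using * by (auto simp: F_def)
    qed
    fix S assume S: "S \<subseteq> N" "S \<notin> F"
    then obtain x where x: "x \<in> N" "x \<notin> S" by (auto simp: F_def)
    have "S \<noteq> N - {x}" using S x by (auto simp: F_def)
    then obtain y where y: "y \<in> N" "y \<notin> S" "y \<noteq> x" using S x by blast
    have "\<not> up_chain (insert S F) S"
      by (rule not_up_chainI[of "N - {x}" _ "N - {y}"]) (use x y S in \<open>auto simp: F_def\<close>)
    moreover have "{} \<in> insert S F" "{} \<subset> S" using S by (auto simp: F_def)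
    ultimately show "contains_Y (insert S F)" unfolding contains_Y_def by blast
  qed
qed

section \<open>Complementation for \<open>X\<close> and the bounds for each kind of member\<close>

lemma saturated_X_top:
  assumes "saturated contains_X N F"
  shows "N \<in> F"
proof (rule ccontr)
  assume N: "N \<notin> F"
  have F: "F \<subseteq> Pow N" using assms by (simp add: saturated_def)
  from assms subset_refl N show False
  proof (cases rule: saturated_X_cases)
    case mid
    from mid(1) show False using F by (elim not_up_chainE) blast
  qed (use F in blast)+
qed

text \<open>Complementing in \<open>N\<close> reverses inclusion and so exchanges the two chain
  conditions; as \<open>X\<close> is self-dual, this will transfer bounds from one kind of member to
  the other.\<close>

lemma down_chain_compl:
  assumes F: "F \<subseteq> Pow N" and c: "c \<subseteq> N"
  shows "up_chain ((-) N ` F) (N - c) \<longleftrightarrow> down_chain F c"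
    and "down_chain ((-) N ` F) (N - c) \<longleftrightarrow> up_chain F c"
proof -
  have [simp]: "N - a \<subseteq> N - b \<longleftrightarrow> b \<subseteq> a" if "b \<subseteq> N" for a b
    using that by blast
  have sub: "a \<subseteq> N" if "a \<in> F" for a using F that by blast
  show "up_chain ((-) N ` F) (N - c) \<longleftrightarrow> down_chain F c"
    unfolding up_chain_def down_chain_def by (auto simp: sub)
  show "down_chain ((-) N ` F) (N - c) \<longleftrightarrow> up_chain F c"
    unfolding up_chain_def down_chain_def by (auto simp: sub c)
qed

lemma contains_X_compl:
  assumes "F \<subseteq> Pow N"
  shows "contains_X ((-) N ` F) \<longleftrightarrow> contains_X F"
proof -
  have "c \<subseteq> N" if "c \<in> F" for c using assms that by blast
  then show ?thesis
    using down_chain_compl[OF assms] by (auto simp: contains_X_def)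
qed

lemma saturated_X_compl:
  assumes "saturated contains_X N F"
  shows "saturated contains_X N ((-) N ` F)"
  unfolding saturated_def
proof (intro conjI allI impI)
  have F: "F \<subseteq> Pow N" and free: "\<not> contains_X F" using assms by (simp_all add: saturated_def)
  show "(-) N ` F \<subseteq> Pow N" by blast
  show "\<not> contains_X ((-) N ` F)" using free contains_X_compl[OF F] by blast
  fix S assume S: "S \<subseteq> N" "S \<notin> (-) N ` F"
  have SS: "N - (N - S) = S" using S by blast
  have "N - S \<notin> F" using S(2) SS by (metis image_eqI)
  then have "contains_X (insert (N - S) F)" using assms by (simp add: saturated_def)
  then have "contains_X ((-) N ` insert (N - S) F)"
    using contains_X_compl[of "insert (N - S) F" N] F by blast
  then show "contains_X (insert S ((-) N ` F))" using SS by simp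
qed

lemma saturated_X_not_chain:
  assumes sat: "saturated contains_X N F" and xy: "x \<in> N" "y \<in> N" "x \<noteq> y"
  shows "\<exists>c\<in>F. \<exists>d\<in>F. \<not> c \<subseteq> d \<and> \<not> d \<subseteq> c"
proof (cases "{x} \<in> F \<and> {y} \<in> F")
  case True
  then show ?thesis using xy by blast
next
  case False
  then obtain p where p: "{p} \<subseteq> N" "{p} \<notin> F" using xy by blast
  have up: ?thesis if "\<not> up_chain F b" for b
    using that by (elim not_up_chainE) blast
  have down: ?thesis if "\<not> down_chain F b" for b
    using that by (elim not_down_chainE) blast
  from sat p show ?thesis
    by (cases rule: saturated_X_cases) (use up down in blast)+
qed

text \<open>The argument for \<open>Y\<close> with the members satisfying \<open>up_chain\<close> in
  place of the non-minimal ones. By freeness every member failing \<open>down_chain\<close> is among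
  them, so the centre \<open>c\<close> from the role \<open>top\<close> can be used.\<close>

lemma card_up_chain_ge:
  assumes N: "finite N" and sat: "saturated contains_X N F"
  shows "card N + 1 \<le> card {c \<in> F. up_chain F c}"
proof -
  have F: "F \<subseteq> Pow N" and free: "\<not> contains_X F" using sat by (auto simp: saturated_def)
  have finF: "finite F" using N F by (meson finite_Pow_iff finite_subset)
  define U where "U = {c \<in> F. up_chain F c}"
  have U_mono: "c \<in> U" if "b \<in> U" "c \<in> F" "b \<subseteq> c" for b c
    using that up_chain_mono unfolding U_def by blast
  have UI: "c \<in> U" if "c \<in> F" "\<not> down_chain F c" for c
    using that free unfolding U_def contains_X_def by blast
  have "N \<in> U"
    using saturated_X_top[OF sat] F by (auto simp: U_def up_chain_def)
  then have "finite U" "U \<noteq> {}" using finF by (auto simp: U_def)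
  from finite_has_minimal[OF this] obtain A0
    where A0: "A0 \<in> U" and min: "\<And>B. B \<in> U \<Longrightarrow> B \<subseteq> A0 \<Longrightarrow> A0 = B"
    by blast
  have A0F: "A0 \<in> F" and A0_up: "up_chain F A0" and UF: "U \<subseteq> F" using A0 by (auto simp: U_def)
  have "card N + 1 \<le> card U"
  proof (rule card_ge_Suc_ground_set)
    show "finite N" by fact
    show "U \<subseteq> Pow N" using F UF by blast
    show "A0 \<in> U" by fact
    show "up_chain U A0" using A0_up UF unfolding up_chain_def by blast
  next
    fix A i assume A: "A \<in> U" "A0 \<subseteq> A" "i \<in> N - A"
      and Amax: "\<And>B. \<lbrakk>B \<in> U; A0 \<subseteq> B; i \<notin> B\<rbrakk> \<Longrightarrow> B \<subseteq> A"
    let ?S = "insert i A"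
    have AF: "A \<in> F" using A UF by blast
    show "?S \<in> U \<or> (\<exists>b\<in>U. \<exists>d\<in>U. i \<in> b \<and> b \<subseteq> ?S \<and> b \<subset> d \<and> \<not> d \<subseteq> ?S \<and> \<not> ?S \<subseteq> d)"
    proof (cases "?S \<in> F")
      case True
      then show ?thesis using U_mono[of A ?S] A by blast
    next
      case False
      have up: "up_chain F ?S" using up_chain_mono[OF A0_up, of ?S] A by blast
      have "?S \<subseteq> N" using A AF F by blast
      from sat this False show ?thesis
      proof (cases rule: saturated_X_cases)
        case mid
        then show ?thesis using up by blast
      next
        case (bottom c)
        then show ?thesis using up_chain_mono[OF up, of c] by blast
      next
        case (top c e)
        have c: "c \<in> U" "up_chain F c" using UI top by (auto simp: U_def)
        have e: "e \<in> U" using U_mono[of c e] c top by blast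
        have "i \<in> c"
        proof (rule ccontr)
          assume "i \<notin> c"
          then have "c \<subseteq> A" using top(4) by blast
          moreover have "c \<subseteq> e" using top(5) by blast
          ultimately have "e \<subseteq> A \<or> A \<subseteq> e" using up_chainD[OF c(2) top(2) AF] by blast
          then have "A \<subseteq> e" "i \<notin> e" using top(6,7) by blast+
          then have "e \<subseteq> A" using Amax[of e] e A(2) by blast
          then show False using top(6) by blast
        qed
        then show ?thesis using top c(1) e by (intro disjI2 bexI[of _ c] bexI[of _ e]) auto
      qed
    qed
  next
    fix j assume j: "j \<in> A0"
    let ?S = "A0 - {j}"
    have two: "j \<notin> c \<or> j \<notin> d"
      if "c \<in> F" "d \<in> F" "?S \<subseteq> c" "?S \<subseteq> d" "\<not> c \<subseteq> d" "\<not> d \<subseteq> c" for c d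
      using up_chainD[OF A0_up, of c d] that by blast
    have ex: "\<exists>C\<in>F. ?S \<subseteq> C \<and> B \<subset> C \<and> j \<notin> C" if "?S \<subseteq> B" "\<not> up_chain F B" for B
      using that(2)
    proof (rule not_up_chainE)
      fix c d assume cd: "c \<in> F" "d \<in> F" "B \<subset> c" "B \<subset> d" "\<not> c \<subseteq> d" "\<not> d \<subseteq> c"
      have "?S \<subseteq> c" "?S \<subseteq> d" using cd that(1) by blast+
      then show ?thesis using two[of c d] cd by blast
    qed
    have "\<exists>C\<in>F. ?S \<subseteq> C \<and> j \<notin> C"
    proof (cases "?S \<in> F")
      case True
      then show ?thesis by blast
    next
      case False
      have "?S \<subseteq> N" using A0F F by blast
      from sat this False show ?thesis
      proof (cases rule: saturated_X_cases)
        case mid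
        then show ?thesis using ex[of ?S] by blast
      next
        case (bottom c)
        then show ?thesis using ex[of c] by blast
      next
        case (top c e)
        then have "c \<in> U" using UI by blast
        then show ?thesis using min[of c] top(4) j by blast
      qed
    qed
    \<comment> \<open>The set is enlarged to a maximal one in order to reach \<open>U\<close>: a
      fork above it would, by \<open>ex\<close>, give a still larger member avoiding
      \<open>j\<close>.\<close>
    then obtain C0 where C0: "C0 \<in> {C \<in> F. ?S \<subseteq> C \<and> j \<notin> C}" by auto
    have "finite {C \<in> F. ?S \<subseteq> C \<and> j \<notin> C}" using finF by simp
    from finite_has_maximal2[OF this C0] obtain C
      where C: "C \<in> {C \<in> F. ?S \<subseteq> C \<and> j \<notin> C}"
        and Cmax: "\<forall>B\<in>{C \<in> F. ?S \<subseteq> C \<and> j \<notin> C}. C \<subseteq> B \<longrightarrow> C = B"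
      by auto
    have "up_chain F C"
    proof (rule ccontr)
      assume "\<not> up_chain F C"
      then obtain B where "B \<in> F" "?S \<subseteq> B" "C \<subset> B" "j \<notin> B" using ex[of C] C by auto
      then show False using Cmax by auto
    qed
    then show "\<exists>C\<in>U. ?S \<subseteq> C \<and> j \<notin> C" using C by (auto simp: U_def)
  qed
  then show ?thesis by (simp add: U_def)
qed

lemma card_down_chain_ge:
  assumes N: "finite N" and sat: "saturated contains_X N F"
  shows "card N + 1 \<le> card {c \<in> F. down_chain F c}"
proof -
  have F: "F \<subseteq> Pow N" using sat by (simp add: saturated_def)
  let ?F = "(-) N ` F"
  have "up_chain ?F (N - c) \<longleftrightarrow> down_chain F c" if "c \<in> F" for c
    using F that by (intro down_chain_compl) auto
  then have "{c \<in> ?F. up_chain ?F c} = (-) N ` {c \<in> F. down_chain F c}"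
    by auto
  moreover have "inj_on ((-) N) {c \<in> F. down_chain F c}"
    using F by (intro inj_onI) blast
  ultimately show ?thesis
    using card_up_chain_ge[OF N saturated_X_compl[OF sat]] by (simp add: card_image)
qed

section \<open>Members with chains both above and below\<close>

lemma disjoint_image: "(\<And>x. x \<in> B \<Longrightarrow> f x \<notin> A) \<Longrightarrow> A \<inter> f ` B = {}"
  by auto

lemma ex_maximal_not_containing:
  assumes "finite F" "d \<in> F" "x \<notin> d"
  obtains m where "m \<in> F" "d \<subseteq> m" "x \<notin> m" "\<forall>g\<in>F. m \<subset> g \<longrightarrow> x \<in> g"
proof -
  have "finite {g \<in> F. x \<notin> g}" "d \<in> {g \<in> F. x \<notin> g}" using assms by auto
  from finite_has_maximal2[OF this] obtain m
    where m: "m \<in> {g \<in> F. x \<notin> g}" "d \<subseteq> m" and max: "\<forall>g\<in>{g \<in> F. x \<notin> g}. m \<subseteq> g \<longrightarrow> m = g"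
    by auto
  show thesis
  proof (rule that[of m])
    show "\<forall>g\<in>F. m \<subset> g \<longrightarrow> x \<in> g"
    proof (intro ballI impI)
      fix g assume "g \<in> F" "m \<subset> g"
      then show "x \<in> g" using max by auto
    qed
  qed (use m in auto)
qed

context
  fixes N :: "'a set" and F :: "'a set set" and t :: "'a set"
  assumes sat: "saturated contains_X N F" and N: "finite N" "card N \<ge> 3"
    and t: "t \<in> F" "up_chain F t" "down_chain F t"
begin

private lemma F: "F \<subseteq> Pow N" and free: "\<not> contains_X F" and tN: "t \<subseteq> N"
  using sat t by (auto simp: saturated_def)

text \<open>Every superset of \<open>t\<close> has a chain above it, so a missing
  \<open>insert i t\<close> can only play the role \<open>top\<close>. Of two incomparable members
  below \<open>c\<close> one contains \<open>i\<close>, as the members inside \<open>t\<close> form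
  a chain. This gives two nested members strictly inside \<open>insert i t\<close>.\<close>

lemma neutral_upper_cases:
  assumes i: "i \<in> N - t"
  obtains (insert) "insert i t \<in> F"
  | (up) a c g where "a \<in> F" "c \<in> F" "g \<in> F" "i \<in> a" "a \<subset> c" "c \<subset> insert i t" "c \<subset> g"
      "\<not> insert i t \<subseteq> g" "up_chain F c" "insert i t \<notin> F"
proof (cases "insert i t \<in> F")
  case True
  then show thesis by (rule insert)
next
  case False
  have up_t: "up_chain F (insert i t)" using up_chain_mono[OF t(2)] by blast
  have "insert i t \<subseteq> N" using i tN by blast
  from sat this False show thesis
  proof (cases rule: saturated_X_cases)
    case mid
    then show thesis using up_t by blast
  next
    case (bottom c)
    then show thesis using up_chain_mono[OF up_t, of c] by blast
  next
    case (top c e)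
    have upc: "up_chain F c" using top(1,3) free by (auto simp: contains_X_def)
    from top(3) obtain a b where ab: "a \<in> F" "b \<in> F" "a \<subset> c" "b \<subset> c" "\<not> a \<subseteq> b" "\<not> b \<subseteq> a"
      by (rule not_down_chainE)
    have "i \<in> a \<or> i \<in> b"
    proof (rule ccontr)
      assume "\<not> ?thesis"
      then have "a \<subseteq> t" "b \<subseteq> t" using ab top(4) by blast+
      then show False using down_chainD[OF t(3) ab(1,2)] ab(5,6) by blast
    qed
    then obtain a' where "a' \<in> F" "i \<in> a'" "a' \<subset> c" using ab by blast
    then show thesis using up[of a' c e] top upc False by blast
  qed
qed

text \<open>Subsets of \<open>t\<close> have chains below them, which leaves the role
  \<open>bottom\<close> for a missing \<open>t - {x}\<close>. Of the two tips of the fork above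
  \<open>c\<close> one misses \<open>x\<close>, or both would contain \<open>t\<close> and be
  comparable.\<close>

lemma neutral_lower_cases:
  assumes x: "x \<in> t"
  obtains (remove) "t - {x} \<in> F"
  | (down) c d where "c \<in> F" "d \<in> F" "t - {x} \<subset> c" "c \<subset> d" "x \<notin> d" "\<not> up_chain F c"
proof (cases "t - {x} \<in> F")
  case True
  then show thesis by (rule remove)
next
  case False
  have down_t: "down_chain F (t - {x})" using down_chain_mono[OF t(3)] by blast
  have "t - {x} \<subseteq> N" using tN by blast
  from sat this False show thesis
  proof (cases rule: saturated_X_cases)
    case mid
    then show thesis using down_t by blast
  next
    case (bottom c)
    from bottom(3) obtain d e where de: "d \<in> F" "e \<in> F" "c \<subset> d" "c \<subset> e" "\<not> d \<subseteq> e" "\<not> e \<subseteq> d"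
      by (rule not_up_chainE)
    have "x \<notin> d \<or> x \<notin> e"
    proof (rule ccontr)
      assume "\<not> ?thesis"
      then have "t \<subseteq> d" "t \<subseteq> e" using de bottom(2) by blast+
      then show False using up_chainD[OF t(2) de(1,2)] de(5,6) by blast
    qed
    then show thesis using down[of c] bottom de by blast
  next
    case (top c e)
    then have "\<not> down_chain F t" using down_chain_mono[of F t c] by blast
    then show thesis using t by blast
  qed
qed

text \<open>With \<open>t\<close> empty the whole family would be a chain.\<close>

lemma neutral_nonempty: "t \<noteq> {}"
proof
  assume "t = {}"
  obtain x y where "x \<in> N" "y \<in> N" "x \<noteq> y"
    using N by (metis card_le_Suc0_iff_eq not_less_eq_eq numeral_3_eq_3 Suc_leD)
  from saturated_X_not_chain[OF sat this]
  obtain c d where "c \<in> F" "d \<in> F" "\<not> c \<subseteq> d" "\<not> d \<subseteq> c"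
    by (elim bexE conjE)
  then show False using up_chainD[OF t(2), of c d] \<open>t = {}\<close> by blast
qed

lemma neutral_not_full: "t \<noteq> N"
proof
  assume "t = N"
  obtain x y where "x \<in> N" "y \<in> N" "x \<noteq> y"
    using N by (metis card_le_Suc0_iff_eq not_less_eq_eq numeral_3_eq_3 Suc_leD)
  from saturated_X_not_chain[OF sat this]
  obtain c d where "c \<in> F" "d \<in> F" "\<not> c \<subseteq> d" "\<not> d \<subseteq> c"
    by (elim bexE conjE)
  then show False using down_chainD[OF t(3), of c d] \<open>t = N\<close> F by blast
qed

lemma neutral_insert_unique:
  assumes "i \<in> N - t" "j \<in> N - t" "insert i t \<in> F" "insert j t \<in> F"
  shows "i = j"
  using up_chainD[OF t(2) assms(3,4)] assms(1,2) by blast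

lemma neutral_remove_unique:
  assumes "x \<in> t" "y \<in> t" "t - {x} \<in> F" "t - {y} \<in> F"
  shows "x = y"
  using down_chainD[OF t(3) assms(3,4)] assms(1,2) by blast

text \<open>The two-element set \<open>insert i t\<close> has no room for the nested nonempty sets
  of the case \<open>up\<close>. So it lies in \<open>F\<close> for each of the at least two points
  \<open>i\<close> outside \<open>t\<close>, against uniqueness.\<close>

lemma neutral_not_singleton: "t \<noteq> {y}"
proof
  assume ty: "t = {y}"
  then have "card (N - t) \<ge> 2" using N tN by (simp add: card_Diff_subset)
  then obtain i j where ij: "i \<in> N - t" "j \<in> N - t" "i \<noteq> j"
    using N(1) by (metis card_le_Suc0_iff_eq finite_Diff not_less_eq_eq numeral_2_eq_2)
  have "insert i t \<in> F" if "i \<in> N - t" for i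
    using that
  proof (cases rule: neutral_upper_cases)
    case (up a c g)
    have "card a < card c" "card c < card (insert i t)"
      using up(5,6) ty by (auto intro!: psubset_card_mono intro: finite_subset)
    moreover have "card (insert i t) \<le> 2" "card a \<noteq> 0"
      using ty up(4-6) that by (auto simp: card_insert_if dest: finite_subset)
    ultimately show ?thesis by simp
  qed
  then show False using neutral_insert_unique ij by blast
qed

text \<open>Only \<open>y\<close> can be added to \<open>t - {x}\<close> without adding
  \<open>x\<close>, which leaves no room for both sets of the case \<open>down\<close>. So
  \<open>t - {x}\<close> lies in \<open>F\<close> for at least two points \<open>x\<close>, against
  uniqueness.\<close>

lemma neutral_not_coatom: "t \<noteq> N - {y}"
proof
  assume ty: "t = N - {y}"
  with neutral_not_full have y: "y \<in> N" by blast
  then have "card t \<ge> 2" using N ty by simp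
  then obtain i j where ij: "i \<in> t" "j \<in> t" "i \<noteq> j"
    using N(1) tN by (metis card_le_Suc0_iff_eq finite_subset not_less_eq_eq numeral_2_eq_2)
  have "t - {x} \<in> F" if x: "x \<in> t" for x
    using x
  proof (cases rule: neutral_lower_cases)
    case (down c d)
    have "d \<subseteq> N" using F down(2) by blast
    then have "d \<subseteq> insert y (t - {x})" using ty down(5) by blast
    then show ?thesis using down(3,4) by blast
  qed
  then show False using neutral_remove_unique ij by blast
qed

text \<open>The \<open>2n + 2\<close> members of \<open>F\<close> are \<open>{}\<close>, \<open>t\<close>, \<open>N\<close>, two sets \<open>c x \<subset> h x\<close> containing \<open>t\<close> up to
  \<open>x\<close> for each \<open>x \<in> t\<close>, and two sets \<open>k i \<subset> e i\<close> contained in \<open>t\<close> up to \<open>i\<close> for each \<open>i \<in> N - t\<close>,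
  except that a single \<open>k z\<close> is discarded: it need not exist when \<open>t \<union> {z} \<in> F\<close>.\<close>

lemma card_ge_of_neutral:
  assumes tmin: "\<And>s. s \<in> F \<Longrightarrow> s \<subset> t \<Longrightarrow> \<not> up_chain F s"
  shows "2 * card N + 2 \<le> card F"
proof -
  have finF: "finite F" using N F by (meson finite_Pow_iff finite_subset)
  have fint: "finite t" using N(1) tN finite_subset by blast
  have "\<exists>c h. c \<in> F \<and> h \<in> F \<and> t - {x} \<subseteq> c \<and> c \<subset> h \<and> x \<notin> h \<and> \<not> up_chain F c \<and>
      (\<forall>g\<in>F. h \<subset> g \<longrightarrow> x \<in> g)" if x: "x \<in> t" for x
  proof -
    have "\<exists>c d. c \<in> F \<and> d \<in> F \<and> t - {x} \<subseteq> c \<and> c \<subset> d \<and> x \<notin> d \<and> \<not> up_chain F c"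
      using x
    proof (cases rule: neutral_lower_cases)
      case remove
      \<comment> \<open>Here \<open>t - {x}\<close> itself serves as \<open>c x\<close>: by
        \<open>tmin\<close> there is a fork above it, and one tip misses \<open>x\<close>.\<close>
      then have nup: "\<not> up_chain F (t - {x})" using tmin x by blast
      then obtain d e where de: "d \<in> F" "e \<in> F" "t - {x} \<subset> d" "t - {x} \<subset> e" "\<not> d \<subseteq> e" "\<not> e \<subseteq> d"
        by (rule not_up_chainE)
      have "x \<notin> d \<or> x \<notin> e"
      proof (rule ccontr)
        assume "\<not> ?thesis"
        then have "t \<subseteq> d" "t \<subseteq> e" using de by blast+
        then show False using up_chainD[OF t(2) de(1,2)] de(5,6) by blast
      qed
      then show ?thesis using remove nup de(1-4) by blast
    next
      case (down c d)
      then show ?thesis by blast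
    qed
    then obtain c d where cd: "c \<in> F" "d \<in> F" "t - {x} \<subseteq> c" "c \<subset> d" "x \<notin> d" "\<not> up_chain F c"
      by blast
    \<comment> \<open>Maximality forces \<open>x\<close> into every larger member, which later
      separates \<open>h x\<close> from \<open>e i\<close>.\<close>
    obtain h where h: "h \<in> F" "d \<subseteq> h" "x \<notin> h" "\<forall>g\<in>F. h \<subset> g \<longrightarrow> x \<in> g"
      using finF cd(2,5) by (rule ex_maximal_not_containing)
    have "c \<subset> h" using cd(4) h(2) by (rule psubset_subset_trans)
    then show ?thesis using cd h by (intro exI[of _ c] exI[of _ h] conjI)
  qed
  then obtain c h where ch: "\<And>x. x \<in> t \<Longrightarrow> c x \<in> F \<and> h x \<in> F \<and> t - {x} \<subseteq> c x \<and> c x \<subset> h x \<and>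
      x \<notin> h x \<and> \<not> up_chain F (c x) \<and> (\<forall>g\<in>F. h x \<subset> g \<longrightarrow> x \<in> g)"
    by metis
  have c: "c x \<in> F" "t - {x} \<subseteq> c x" "c x \<subset> h x" "\<not> up_chain F (c x)"
    and h: "h x \<in> F" "x \<notin> h x" "\<And>g. g \<in> F \<Longrightarrow> h x \<subset> g \<Longrightarrow> x \<in> g" if "x \<in> t" for x
    using ch[OF that] by simp_all
  have "\<exists>e k. e \<in> F \<and> i \<in> e \<and> e \<subseteq> insert i t \<and> up_chain F e \<and>
      (e = insert i t \<or> (\<exists>g\<in>F. e \<subset> g \<and> \<not> insert i t \<subseteq> g)) \<and>
      (insert i t \<notin> F \<longrightarrow> k \<in> F \<and> i \<in> k \<and> k \<subset> e \<and> e \<subset> insert i t)" if i: "i \<in> N - t" for i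
    using i
  proof (cases rule: neutral_upper_cases)
    \<comment> \<open>In this case \<open>k i\<close> is arbitrary; it is constrained only when
      \<open>insert i t\<close> is missing.\<close>
    case insert
    moreover have "up_chain F (insert i t)" using up_chain_mono[OF t(2)] by blast
    ultimately show ?thesis by (intro exI[of _ "insert i t"]) auto
  next
    case (up a c g)
    have "i \<in> c" "c \<subseteq> insert i t" using up(4-6) by blast+
    moreover have "\<exists>g\<in>F. c \<subset> g \<and> \<not> insert i t \<subseteq> g" using up(3,7,8) by (intro bexI[of _ g] conjI)
    ultimately show ?thesis using up by (intro exI[of _ c] exI[of _ a]) simp
  qed
  then obtain e k where ek: "\<And>i. i \<in> N - t \<Longrightarrow> e i \<in> F \<and> i \<in> e i \<and> e i \<subseteq> insert i t \<and> up_chain F (e i) \<and>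
      (e i = insert i t \<or> (\<exists>g\<in>F. e i \<subset> g \<and> \<not> insert i t \<subseteq> g)) \<and>
      (insert i t \<notin> F \<longrightarrow> k i \<in> F \<and> i \<in> k i \<and> k i \<subset> e i \<and> e i \<subset> insert i t)"
    by metis
  have e: "e i \<in> F" "i \<in> e i" "e i \<subseteq> insert i t" "up_chain F (e i)"
      "e i = insert i t \<or> (\<exists>g\<in>F. e i \<subset> g \<and> \<not> insert i t \<subseteq> g)"
    and k: "insert i t \<notin> F \<Longrightarrow> k i \<in> F \<and> i \<in> k i \<and> k i \<subset> e i \<and> e i \<subset> insert i t"
    if "i \<in> N - t" for i
    using ek[OF that] by simp_all
  \<comment> \<open>\<open>z\<close> is the only point with \<open>insert z t\<close> in
    \<open>F\<close> if there is one, and any point outside \<open>t\<close> otherwise. Either way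
    \<open>k i\<close> is a member for every other \<open>i\<close>.\<close>
  obtain z where z: "z \<in> N - t" and z_unique: "\<And>i. i \<in> N - t \<Longrightarrow> i \<noteq> z \<Longrightarrow> insert i t \<notin> F"
  proof (cases "\<exists>z\<in>N - t. insert z t \<in> F")
    case True
    then show ?thesis using that neutral_insert_unique by blast
  next
    case False
    moreover obtain z where "z \<in> N - t" using neutral_not_full tN by blast
    ultimately show ?thesis using that by blast
  qed
  \<comment> \<open>Two strict inclusions lead from \<open>insert i t\<close>, of size
    \<open>card t + 1\<close>, down to \<open>k i\<close>.\<close>
  have kz: "k i \<in> F" "i \<in> k i" "k i \<subset> e i" "k i \<subseteq> insert i t" "card (k i) < card t"
    if "i \<in> N - t" "i \<noteq> z" for i
  proof -
    note ki = k[OF that(1) z_unique[OF that]]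
    then show "k i \<in> F" "i \<in> k i" "k i \<subset> e i" "k i \<subseteq> insert i t" by auto
    have fin: "finite (insert i t)" using fint by simp
    have "card (e i) < card (insert i t)"
      using ki fin by (intro psubset_card_mono) auto
    moreover have "card (k i) < card (e i)"
      using ki finite_subset[OF _ fin, of "e i"] by (intro psubset_card_mono) auto
    moreover have "card (insert i t) = Suc (card t)" using that fint by simp
    ultimately show "card (k i) < card t" by simp
  qed
  \<comment> \<open>This separates \<open>c x\<close> and \<open>h x\<close> from the smaller sets
    \<open>k i\<close>: the point \<open>i\<close> makes up for the possible loss of
    \<open>x\<close>.\<close>
  have big: "card t \<le> card C" if C: "C \<in> F" "t - {x} \<subseteq> C" "i \<in> C" "i \<notin> t" "x \<in> t" for C x i
  proof -
    have "finite C" using C(1) F N(1) finite_subset by blast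
    moreover have "insert i (t - {x}) \<subseteq> C" using C by blast
    ultimately have "card (insert i (t - {x})) \<le> card C" by (rule card_mono)
    then show ?thesis using C fint by (simp add: card_Suc_Diff1)
  qed
  have c_h: "c x \<noteq> h y" if xy: "x \<in> t" "y \<in> t" for x y
  proof (cases "x = y")
    case True
    then show ?thesis using c(3)[OF xy(1)] by blast
  next
    case False
    have "y \<in> c x" using c(2)[OF xy(1)] False xy by blast
    then show ?thesis using h(2)[OF xy(2)] by blast
  qed
  have h_sup: "t - {x} \<subseteq> h x" if "x \<in> t" for x
    using c(2,3)[OF that] by blast
  have c_e: "c x \<noteq> e i" if "x \<in> t" "i \<in> N - t" for x i
    using c(4)[OF that(1)] e(4)[OF that(2)] by metis
  have c_k: "c x \<noteq> k i" if "x \<in> t" "i \<in> N - t" "i \<noteq> z" for x i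
    using big[OF c(1,2)[OF that(1)], of i] that kz[OF that(2,3)] by auto
  have h_k: "h x \<noteq> k i" if "x \<in> t" "i \<in> N - t" "i \<noteq> z" for x i
    using big[OF h(1)[OF that(1)] h_sup[OF that(1)], of i] that kz[OF that(2,3)] by auto
  have h_e: "h x \<noteq> e i" if xi: "x \<in> t" "i \<in> N - t" for x i
  proof
    assume eq: "h x = e i"
    \<comment> \<open>As \<open>e i\<close> misses \<open>x\<close>, it has a proper superset
      \<open>g\<close> in \<open>F\<close> that does not contain \<open>insert i t\<close>. But
      maximality of \<open>h x\<close> puts \<open>x\<close> into \<open>g\<close>.\<close>
    have "e i \<noteq> insert i t" using h(2)[OF xi(1)] eq xi(1) by blast
    then obtain g where g: "g \<in> F" "e i \<subset> g" "\<not> insert i t \<subseteq> g"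
      using e(5)[OF xi(2)] by blast
    then have "x \<in> g" using h(3)[OF xi(1)] eq by simp
    moreover have "t - {x} \<subseteq> g" "i \<in> g" using g(2) h_sup[OF xi(1)] e(2)[OF xi(2)] eq by blast+
    ultimately show False using g(3) by blast
  qed
  have e_k: "e i \<noteq> k j" if ij: "i \<in> N - t" "j \<in> N - t" "j \<noteq> z" for i j
  proof (cases "i = j")
    case True
    then show ?thesis using kz(3)[OF ij(2,3)] by blast
  next
    case False
    then have "i \<notin> k j" using kz(4)[OF ij(2,3)] ij(1) by blast
    then show ?thesis using e(2)[OF ij(1)] by blast
  qed
  have in_lower: "inj_on f A" if "A \<subseteq> t" "\<And>x. x \<in> A \<Longrightarrow> t - {x} \<subseteq> f x \<and> x \<notin> f x" for f A
  proof (rule inj_onI, rule ccontr)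
    fix x y assume "x \<in> A" "y \<in> A" "f x = f y" "x \<noteq> y"
    then show False using that(2)[of x] that(2)[of y] that(1) by auto
  qed
  have in_upper: "inj_on f A" if "A \<subseteq> N - t" "\<And>i. i \<in> A \<Longrightarrow> i \<in> f i \<and> f i \<subseteq> insert i t" for f A
  proof (rule inj_onI, rule ccontr)
    fix x y assume "x \<in> A" "y \<in> A" "f x = f y" "x \<noteq> y"
    then show False using that(2)[of x] that(2)[of y] that(1) by auto
  qed
  have c_notin: "x \<notin> c x" if "x \<in> t" for x using c(3)[OF that] h(2)[OF that] by blast
  let ?t' = "N - t" and ?t'' = "N - t - {z}"
  have cards: "card (c ` t) = card t" "card (h ` t) = card t"
    "card (e ` ?t') = card ?t'" "card (k ` ?t'') = card ?t''"
    using c(2) c_notin h(2) h_sup e(2,3) kz(2,4)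
    by (intro card_image in_lower in_upper; auto)+
  let ?E = "{{}, t, N}"
  have card_E: "card ?E = 3"
  proof -
    have "N \<noteq> {}" using N by auto
    then show ?thesis using neutral_nonempty neutral_not_full by simp
  qed
  have e_ne: "e i \<noteq> {}" "e i \<noteq> t" "e i \<noteq> N" if "i \<in> N - t" for i
  proof -
    show "e i \<noteq> {}" "e i \<noteq> t" using e(2)[OF that] that by auto
    \<comment> \<open>Otherwise \<open>t\<close> would be the coatom \<open>N - {i}\<close>.\<close>
    have "insert i t \<noteq> N" using neutral_not_coatom[of i] that by blast
    then show "e i \<noteq> N" using e(3)[OF that] that tN by blast
  qed
  have k_ne: "k i \<noteq> {}" "k i \<noteq> t" "k i \<noteq> N" if "i \<in> N - t" "i \<noteq> z" for i
  proof -
    show "k i \<noteq> {}" "k i \<noteq> t" using kz(2)[OF that] that by auto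
    show "k i \<noteq> N" using kz(3)[OF that] e(1)[OF that(1)] F by blast
  qed
  have c_ne: "c x \<noteq> {}" "c x \<noteq> t" "c x \<noteq> N" if "x \<in> t" for x
  proof -
    show "c x \<noteq> t" "c x \<noteq> N" using c_notin[OF that] that tN by auto
    \<comment> \<open>\<open>t - {x}\<close> is nonempty, as \<open>t\<close> is not a
      singleton.\<close>
    show "c x \<noteq> {}" using c(2)[OF that] neutral_not_singleton[of x] that by blast
  qed
  have h_ne: "h x \<noteq> {}" "h x \<noteq> t" "h x \<noteq> N" if "x \<in> t" for x
    using h(2)[OF that] that tN c(3)[OF that] by auto
  have fin: "finite ?E" "finite (c ` t)" "finite (h ` t)" "finite (e ` ?t')" "finite (k ` ?t'')"
    using fint N(1) by auto
  have "c x \<notin> ?E" if "x \<in> t" for x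
    using c_ne[OF that] by auto
  then have "?E \<inter> c ` t = {}" by (rule disjoint_image)
  then have "card (?E \<union> c ` t) = 3 + card t"
    using card_E cards(1) fin by (simp add: card_Un_disjoint del: Un_insert_left)
  moreover have "h x \<notin> ?E \<union> c ` t" if "x \<in> t" for x
    using h_ne[OF that] c_h[OF _ that] by (auto dest: sym)
  then have "(?E \<union> c ` t) \<inter> h ` t = {}" by (rule disjoint_image)
  ultimately have "card (?E \<union> c ` t \<union> h ` t) = 3 + 2 * card t"
    using cards(2) fin by (simp add: card_Un_disjoint del: Un_insert_left)
  moreover have "e i \<notin> ?E \<union> c ` t \<union> h ` t" if "i \<in> ?t'" for i
    using e_ne[OF that] c_e[OF _ that] h_e[OF _ that] by (auto dest: sym)
  then have "(?E \<union> c ` t \<union> h ` t) \<inter> e ` ?t' = {}" by (rule disjoint_image)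
  ultimately have "card (?E \<union> c ` t \<union> h ` t \<union> e ` ?t') = 3 + 2 * card t + card ?t'"
    using cards(3) fin by (simp add: card_Un_disjoint del: Un_insert_left)
  moreover have "k i \<notin> ?E \<union> c ` t \<union> h ` t \<union> e ` ?t'" if "i \<in> ?t''" for i
  proof -
    from that have i: "i \<in> ?t'" "i \<noteq> z" by auto
    show ?thesis
      using k_ne[OF i] c_k[OF _ i] h_k[OF _ i] e_k[OF _ i] by (auto dest: sym)
  qed
  then have "(?E \<union> c ` t \<union> h ` t \<union> e ` ?t') \<inter> k ` ?t'' = {}" by (rule disjoint_image)
  ultimately have total: "card (?E \<union> c ` t \<union> h ` t \<union> e ` ?t' \<union> k ` ?t'') = 3 + 2 * card t + card ?t' + card ?t''"
    using cards(4) fin by (simp add: card_Un_disjoint del: Un_insert_left)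
  have "N \<in> F" by (rule saturated_X_top[OF sat])
  \<comment> \<open>The family of complements is saturated and so contains \<open>N\<close>, the
    complement of the empty set.\<close>
  moreover have "{} \<in> F"
  proof -
    obtain x where "x \<in> F" "N = N - x" using saturated_X_top[OF saturated_X_compl[OF sat]] by blast
    moreover have "x = {}" using calculation F by blast
    ultimately show ?thesis by simp
  qed
  ultimately have "?E \<union> c ` t \<union> h ` t \<union> e ` ?t' \<union> k ` ?t'' \<subseteq> F"
    using t(1) c(1) h(1) e(1) kz(1) by auto
  \<comment> \<open>Leaving out one \<open>k z\<close> turns \<open>3 + 2 * card N\<close> into
    \<open>2 * card N + 2\<close>.\<close>
  then have "3 + 2 * card t + card ?t' + card ?t'' \<le> card F"
    using total card_mono[OF finF] by metis
  moreover have "card ?t'' + 1 = card ?t'" using card_Suc_Diff1[of ?t' z] z N(1) by simp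
  moreover have "card t + card ?t' = card N"
    using N(1) tN fint by (simp add: card_Diff_subset card_mono)
  ultimately show ?thesis by linarith
qed

end

section \<open>The value for \<open>X\<close> and the conclusion\<close>

lemma card_saturated_X_ge:
  assumes N: "finite N" "card N \<ge> 3" and sat: "saturated contains_X N F"
  shows "2 * card N + 2 \<le> card F"
proof -
  have "F \<subseteq> Pow N" using sat by (simp add: saturated_def)
  then have finF: "finite F" using N by (meson finite_Pow_iff finite_subset)
  let ?U = "{c \<in> F. up_chain F c}" and ?D = "{c \<in> F. down_chain F c}"
  show ?thesis
  proof (cases "?U \<inter> ?D = {}")
    case True
    have "card ?U + card ?D = card (?U \<union> ?D)"
      using True finF by (intro card_Un_disjoint[symmetric]) auto
    also have "\<dots> \<le> card F" using finF by (intro card_mono) auto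
    finally show ?thesis
      using card_up_chain_ge[OF N(1) sat] card_down_chain_ge[OF N(1) sat] by simp
  next
    case False
    have "finite (?U \<inter> ?D)" using finF by simp
    from finite_has_minimal[OF this False] obtain t
      where t: "t \<in> ?U \<inter> ?D" and tmin: "\<forall>s\<in>?U \<inter> ?D. s \<subseteq> t \<longrightarrow> t = s"
      by blast
    have t': "t \<in> F" "up_chain F t" "down_chain F t" using t by auto
    \<comment> \<open>A member below \<open>t\<close> inherits the chain below it, so a chain above
      it would contradict the minimality of \<open>t\<close>.\<close>
    have "\<not> up_chain F s" if "s \<in> F" "s \<subset> t" for s
    proof
      assume "up_chain F s"
      moreover have "down_chain F s" using down_chain_mono[OF t'(3)] that by blast
      ultimately show False using tmin that by auto
    qed
    then show ?thesis using card_ge_of_neutral[OF sat N t'] by blast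
  qed
qed

text \<open>Coatoms and the full set have no fork above them, the empty set and singletons no
  incomparable pair below, so no member is the centre of a copy. A missing set contains two points
  and omits two, hence lies above two singletons and below two coatoms. With at least three points
  no singleton is a coatom.\<close>

lemma saturated_X_levels:
  assumes N: "finite N" "card N \<ge> 3"
  defines "F \<equiv> {{}, N} \<union> (\<lambda>i. N - {i}) ` N \<union> (\<lambda>i. {i}) ` N"
  shows "saturated contains_X N F" and "card F = 2 * card N + 2"
proof -
  have "N \<noteq> {}" using N by auto
  have ne: "N - {i} \<noteq> {}" "{i} \<noteq> N" "N - {i} \<noteq> {j}" for i j
  proof -
    have "\<not> N \<subseteq> {i, j}" for j
      using card_mono[of "{i, j}" N] card_insert_le_m1[of 2 "{j}" i] N by auto
    then show "N - {i} \<noteq> {}" "{i} \<noteq> N" "N - {i} \<noteq> {j}" by blast+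
  qed
  let ?C = "{{}, N} \<union> (\<lambda>i. N - {i}) ` N"
  have "card ?C = card N + 2" using saturated_Y_coatoms(2)[of N] N by simp
  moreover have "card ((\<lambda>i. {i}) ` N) = card N" by (intro card_image) simp
  moreover have "card F = card ?C + card ((\<lambda>i. {i}) ` N)"
    unfolding F_def using N ne by (intro card_Un_disjoint) auto
  ultimately show "card F = 2 * card N + 2" by simp
  show "saturated contains_X N F"
    unfolding saturated_def
  proof (intro conjI allI impI)
    show "F \<subseteq> Pow N" by (auto simp: F_def)
    show "\<not> contains_X F"
    proof
      assume "contains_X F"
      then obtain c where c: "c \<in> F" "\<not> up_chain F c" "\<not> down_chain F c"
        unfolding contains_X_def by blast
      from c(2) obtain d e where de: "d \<in> F" "e \<in> F" "c \<subset> d" "c \<subset> e" "\<not> d \<subseteq> e" "\<not> e \<subseteq> d"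
        by (rule not_up_chainE)
      from c(3) obtain a b where ab: "a \<in> F" "b \<in> F" "a \<subset> c" "b \<subset> c" "\<not> a \<subseteq> b" "\<not> b \<subseteq> a"
        by (rule not_down_chainE)
      have sub: "x \<subseteq> N" if "x \<in> F" for x using that by (auto simp: F_def)
      have "d \<noteq> N" using de sub by auto
      then have "c \<noteq> N - {i}" "c \<noteq> N" for i
        using de(3) sub[OF de(1)] by blast+
      moreover have "a \<noteq> {}" using ab by auto
      then have "c \<noteq> {i}" "c \<noteq> {}" for i
        using ab(3) by blast+
      ultimately show False using c(1) by (auto simp: F_def)
    qed
    fix S assume S: "S \<subseteq> N" "S \<notin> F"
    then obtain x where x: "x \<in> N" "x \<notin> S" by (auto simp: F_def)
    have "S \<noteq> N - {x}" using S x by (auto simp: F_def)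
    then obtain y where y: "y \<in> N" "y \<notin> S" "y \<noteq> x" using S x by blast
    obtain u where u: "u \<in> S" using S by (auto simp: F_def)
    have "S \<noteq> {u}" using S u by (auto simp: F_def)
    then obtain v where v: "v \<in> S" "v \<noteq> u" using u by blast
    have "\<not> up_chain (insert S F) S"
      by (rule not_up_chainI[of "N - {x}" _ "N - {y}"]) (use x y S in \<open>auto simp: F_def\<close>)
    moreover have "\<not> down_chain (insert S F) S"
      by (rule not_down_chainI[of "{u}" _ "{v}"]) (use u v S in \<open>auto simp: F_def\<close>)
    ultimately show "contains_X (insert S F)" unfolding contains_X_def by blast
  qed
qed

theorem theorem1p6:
  fixes n :: nat
  assumes "n \<ge> 3"
  shows "sat_star n Y_poset = n + 2 \<and> sat_star n X_poset = 2 * n + 2"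
proof
  have N: "finite {1..n}" "card {1..n} \<ge> 2" "card {1..n} \<ge> 3" using assms by auto
  show "sat_star n Y_poset = n + 2"
    unfolding sat_star_def induced_saturated_Y_iff
  proof (rule cInf_eq_minimum)
    show "n + 2 \<in> {card F |F. saturated contains_Y {1..n} F}"
      using saturated_Y_coatoms[OF N(1,2)] by force
  qed (use card_saturated_Y_ge[OF N(1,2)] in auto)
  show "sat_star n X_poset = 2 * n + 2"
    unfolding sat_star_def induced_saturated_X_iff
  proof (rule cInf_eq_minimum)
    show "2 * n + 2 \<in> {card F |F. saturated contains_X {1..n} F}"
      using saturated_X_levels[OF N(1,3)] by force
  qed (use card_saturated_X_ge[OF N(1,3)] in auto)
qed

end
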